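(* Let $\Phi$ be the simply-laced Kac–Moody root system of rank $4$ with fundamental roots $\alpha_1,\alpha_2,\alpha_3,\alpha_4$ whose Dynkin diagram has exactly the (simple) edges $\{1,2\},\{1,3\},\{2,3\},\{1,4\}$ (a triangle on the vertices $1,2,3$ with vertex $4$ attached to vertex $1$). For $n\in\mathbb Z_{\ge0}$ set $$\beta_n=6n(n+1)\,\alpha_1+n(3n+2)\,\alpha_2+(n+1)(3n+1)\,\alpha_3+3n(n+1)\,\alpha_4,$$ and let $\beta_n'$ be obtained from $\beta_n$ by swapping the coefficients of $\alpha_2$ and $\alpha_3$: $$\beta_n'=6n(n+1)\,\alpha_1+(n+1)(3n+1)\,\alpha_2+n(3n+2)\,\alpha_3+3n(n+1)\,\alpha_4.$$ (In particular $\beta_0=\alpha_3$ and $\beta_0'=\alpha_2$.) Then the basis for $Z_s(\alpha_4)$ is provided by the family of roots $\beta_n,\beta_n'$, $n\in\mathbb Z_{\ge0}$. Moreover, for every $n$ the roots $\beta_n$ and $\beta_n'$ cannot be expressed in terms of the $\beta_m,\beta_m'$ with $m<n$ (no positive integer multiple of $\beta_n$ or of $\beta'_n$ is a nonnegative integer linear combination of them), and the roots $\beta_1,\beta_1',\ldots,\beta_n,\beta_n'$ are weakly independent.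
   Context: $\Phi$ is the root system of the generalized Cartan matrix with diagonal entries $2$, entry $-1$ for each pair of adjacent vertices and $0$ for non-adjacent pairs. It is of hyperbolic type. $\Phi_{\mathrm{re}}$ denotes its set of real roots. For $\alpha\in\Phi_{\mathrm{re}}$ and $\beta\in\Phi$ put $C(\alpha,\beta)=(\mathbb Z_{>0}\alpha+\mathbb Z_{>0}\beta)\cap\Phi_{\mathrm{re}}$, $Z(\alpha)=\{\beta\in\Phi\mid C(\alpha,\beta)=\varnothing\}$ and $Z_s(\alpha)=Z(\alpha)\cap(-Z(\alpha))$. A set $\Gamma$ of roots is weakly independent if for every $\gamma\in\Gamma$ one has $\mathbb Z\gamma\cap\sum_{\gamma'\in\Gamma\setminus\{\gamma\}}\mathbb Z_{\ge0}\gamma'=\{0\}$. The (weak) basis of a subsystem $\Omega$ of $\Phi$ is the set $\Upsilon$ of positive real roots of $\Omega$ obtained as follows: list the positive real roots of $\Omega$ as $\gamma_1,\gamma_2,\ldots$ in an order respecting the height (sum of coefficients in the $\alpha_i$); put $\gamma_1\in\Upsilon$, and for $k>1$ put $\gamma_k\in\Upsilon$ if and only if $\gamma_k\notin\sum_{i=1}^{k-1}\mathbb Z_{\ge0}\gamma_i$. *)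

theory Defs
  imports "HOL-Analysis.Analysis"
begin

section \<open>Root systems of generalized Cartan matrices\<close>

text \<open>
  Elements of the root lattice are written in coordinates with respect to the fundamental roots.
  The root system is given by Kac's description: the real roots are the Weyl group orbits of
  the fundamental roots, and the imaginary roots are, up to sign, the Weyl group orbits of the
  nonzero elements with nonnegative coordinates and connected support on which all
  fundamental coroots are nonpositive.
\<close>

type_synonym 'n lattice = "int ^ 'n"

definition fund_root :: "'n \<Rightarrow> ('n::finite) lattice" where
  "fund_root i = axis i 1"

definition coroot_pairing :: "int ^ 'n ^ 'n \<Rightarrow> ('n::finite) lattice \<Rightarrow> 'n \<Rightarrow> int" where
  "coroot_pairing A x i = (\<Sum>j\<in>UNIV. A $ i $ j * x $ j)"

definition fund_reflection :: "int ^ 'n ^ 'n \<Rightarrow> 'n \<Rightarrow> ('n::finite) lattice \<Rightarrow> 'n lattice" where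
  "fund_reflection A i x = x - coroot_pairing A x i *s fund_root i"

text \<open>The fundamental reflections are involutions, so no inverses are needed to generate the group.\<close>

inductive_set weyl_group :: "int ^ 'n ^ 'n \<Rightarrow> (('n::finite) lattice \<Rightarrow> 'n lattice) set"
  for A where
  weyl_id: "id \<in> weyl_group A"
| weyl_step: "w \<in> weyl_group A \<Longrightarrow> fund_reflection A i \<circ> w \<in> weyl_group A"

definition real_roots :: "int ^ 'n ^ 'n \<Rightarrow> ('n::finite) lattice set" where
  "real_roots A = {w (fund_root i) | w i. w \<in> weyl_group A}"

definition support :: "('n::finite) lattice \<Rightarrow> 'n set" where
  "support x = {i. x $ i \<noteq> 0}"

definition connected_in :: "int ^ 'n ^ 'n \<Rightarrow> ('n::finite) set \<Rightarrow> bool" where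
  "connected_in A S \<longleftrightarrow> (\<forall>i\<in>S. \<forall>j\<in>S. (i, j) \<in> {(k, l). k \<in> S \<and> l \<in> S \<and> A $ k $ l \<noteq> 0}\<^sup>*)"

definition imaginary_cone :: "int ^ 'n ^ 'n \<Rightarrow> ('n::finite) lattice set" where
  "imaginary_cone A = {x. x \<noteq> 0 \<and> (\<forall>i. 0 \<le> x $ i) \<and> connected_in A (support x) \<and>
     (\<forall>i. coroot_pairing A x i \<le> 0)}"

definition pos_imaginary_roots :: "int ^ 'n ^ 'n \<Rightarrow> ('n::finite) lattice set" where
  "pos_imaginary_roots A = {w x | w x. w \<in> weyl_group A \<and> x \<in> imaginary_cone A}"

definition roots :: "int ^ 'n ^ 'n \<Rightarrow> ('n::finite) lattice set" where
  "roots A = real_roots A \<union> pos_imaginary_roots A \<union> uminus ` pos_imaginary_roots A"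

section \<open>The sets $C(\alpha,\beta)$, $Z(\alpha)$ and $Z_s(\alpha)$\<close>

definition C_set :: "int ^ 'n ^ 'n \<Rightarrow> ('n::finite) lattice \<Rightarrow> 'n lattice \<Rightarrow> 'n lattice set" where
  "C_set A \<alpha> \<beta> = {p *s \<alpha> + q *s \<beta> | p q. 0 < p \<and> 0 < q} \<inter> real_roots A"

definition Z_set :: "int ^ 'n ^ 'n \<Rightarrow> ('n::finite) lattice \<Rightarrow> 'n lattice set" where
  "Z_set A \<alpha> = {\<beta> \<in> roots A. C_set A \<alpha> \<beta> = {}}"

definition Zs_set :: "int ^ 'n ^ 'n \<Rightarrow> ('n::finite) lattice \<Rightarrow> 'n lattice set" where
  "Zs_set A \<alpha> = Z_set A \<alpha> \<inter> uminus ` Z_set A \<alpha>"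

section \<open>Weak independence and weak bases\<close>

definition nonneg_comb :: "('n::finite) lattice set \<Rightarrow> 'n lattice set" where
  "nonneg_comb S = {\<Sum>\<gamma>\<in>F. int (c \<gamma>) *s \<gamma> | F c. finite F \<and> F \<subseteq> S}"

definition weakly_independent :: "int ^ 'n ^ 'n \<Rightarrow> ('n::finite) lattice set \<Rightarrow> bool" where
  "weakly_independent A \<Gamma> \<longleftrightarrow> \<Gamma> \<subseteq> roots A \<and>
     (\<forall>\<gamma>\<in>\<Gamma>. range (\<lambda>m::int. m *s \<gamma>) \<inter> nonneg_comb (\<Gamma> - {\<gamma>}) = {0})"

definition height :: "('n::finite) lattice \<Rightarrow> int" where
  "height x = (\<Sum>i\<in>UNIV. x $ i)"

definition pos_real_roots_of :: "int ^ 'n ^ 'n \<Rightarrow> ('n::finite) lattice set \<Rightarrow> 'n lattice set" where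
  "pos_real_roots_of A \<Omega> = {\<gamma> \<in> \<Omega> \<inter> real_roots A. \<forall>i. 0 \<le> \<gamma> $ i}"

text \<open>
  Indices start at \<open>0\<close>; the index set is an initial segment of the naturals, since
  there may be finitely or infinitely many positive real roots.
\<close>

definition height_listing ::
  "int ^ 'n ^ 'n \<Rightarrow> ('n::finite) lattice set \<Rightarrow> nat set \<Rightarrow> (nat \<Rightarrow> 'n lattice) \<Rightarrow> bool" where
  "height_listing A \<Omega> I g \<longleftrightarrow>
     (\<forall>k\<in>I. \<forall>i<k. i \<in> I) \<and> bij_betw g I (pos_real_roots_of A \<Omega>) \<and>
     (\<forall>i\<in>I. \<forall>k\<in>I. i \<le> k \<longrightarrow> height (g i) \<le> height (g k))"

text \<open>
  The listing is not unique (roots of equal height may be permuted), so the basis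
  is required to be the outcome for every listing, and some listing is required to exist.
\<close>

definition is_weak_basis ::
  "int ^ 'n ^ 'n \<Rightarrow> ('n::finite) lattice set \<Rightarrow> 'n lattice set \<Rightarrow> bool" where
  "is_weak_basis A \<Omega> \<Upsilon> \<longleftrightarrow>
     (\<exists>I g. height_listing A \<Omega> I g) \<and>
     (\<forall>I g. height_listing A \<Omega> I g \<longrightarrow>
        \<Upsilon> = {g k | k. k \<in> I \<and> g k \<notin> nonneg_comb (g ` {..<k})})"

section \<open>The triangle with a tail\<close>

text \<open>In the index type \<open>4\<close> the numeral \<open>4\<close> denotes the same element as \<open>0\<close>;
  its four elements are \<open>1, 2, 3, 4\<close>.\<close>

definition simply_laced_matrix :: "('n::finite) set set \<Rightarrow> int ^ 'n ^ 'n" where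
  "simply_laced_matrix E = (\<chi> i j. if i = j then 2 else if {i, j} \<in> E then -1 else 0)"

definition cartan :: "int ^ 4 ^ 4" where
  "cartan = simply_laced_matrix {{1, 2}, {1, 3}, {2, 3}, {1, 4}}"

abbreviation \<alpha> :: "4 \<Rightarrow> 4 lattice" where
  "\<alpha> \<equiv> fund_root"

definition \<beta> :: "nat \<Rightarrow> 4 lattice" where
  "\<beta> n = int (6 * n * (n + 1)) *s \<alpha> 1 + int (n * (3 * n + 2)) *s \<alpha> 2
       + int ((n + 1) * (3 * n + 1)) *s \<alpha> 3 + int (3 * n * (n + 1)) *s \<alpha> 4"

definition \<beta>' :: "nat \<Rightarrow> 4 lattice" where
  "\<beta>' n = int (6 * n * (n + 1)) *s \<alpha> 1 + int ((n + 1) * (3 * n + 1)) *s \<alpha> 2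
        + int (n * (3 * n + 2)) *s \<alpha> 3 + int (3 * n * (n + 1)) *s \<alpha> 4"

lemma \<beta>_0: "\<beta> 0 = \<alpha> 3" and \<beta>'_0: "\<beta>' 0 = \<alpha> 2"
  by (simp_all add: \<beta>_def \<beta>'_def vec_eq_iff)

lemma UNIV_index: "(UNIV :: 4 set) = {1, 2, 3, 4}" and card_index: "card {1, 2, 3, 4 :: 4} = 4"
  using UNIV_4 by (simp_all flip: UNIV_4)

end

theory Submission
  imports Defs
begin

text \<open>
  A real root \<open>x\<close> lies in \<open>Z\<^sub>s(\<alpha>\<^sub>4)\<close> exactly when it is orthogonal to \<open>\<alpha>\<^sub>4\<close>: otherwise \<open>x\<close> or
  \<open>-x\<close> has negative pairing with \<open>\<alpha>\<^sub>4\<close>, and its reflection in \<open>\<alpha>\<^sub>4\<close> is a real root in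
  \<open>C(\<alpha>\<^sub>4, \<plusminus>x)\<close>, whereas for orthogonal \<open>x\<close> the norm of \<open>p \<alpha>\<^sub>4 + q x\<close> is too large. So the problem
  takes place in the rank 3 lattice of vectors with \<open>x\<^sub>1 = 2 x\<^sub>4\<close>. Good coordinates on it are the
  level \<open>k = x\<^sub>2 + x\<^sub>3 - x\<^sub>1\<close>, which is the pairing with a null vector, together with
  \<open>E = x\<^sub>4 - x\<^sub>3\<close> and \<open>c = x\<^sub>4\<close>. The norm equation becomes \<open>k (c - k - 3 E) = 3 E\<^sup>2 - 1\<close>, and it forces
  positive roots to have positive level. Those of level 1 are parametrised by \<open>E = e \<in> \<int>\<close>; they
  form one family \<open>\<theta> e\<close>, lying on a parabola, whose two halves are the \<open>\<beta>'\<^sub>n\<close> (\<open>e = n\<close>) and the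
  \<open>\<beta>\<^sub>n\<close> (\<open>e = -n-1\<close>). They are real roots because a translation in the Weyl group, which fixes
  the null vector, shifts \<open>e\<close> by 1.

  All the independence statements come from one linear functional. For each \<open>e\<close>, \<open>separator e\<close>,
  which sends \<open>x\<close> to \<open>level x - (\<theta> e, x)\<close>, is \<open>-1\<close> at \<open>\<theta> e\<close> and nonnegative at every other
  positive root in \<open>Z\<^sub>s(\<alpha>\<^sub>4)\<close>, since \<open>k * separator e x = 3 (E - k e)\<^sup>2 - 1\<close>. Hence no nonzero multiple
  of \<open>\<theta> e\<close> is a nonnegative combination of other such roots (\<open>\<theta>_multiple_notin\<close>).

  Conversely (\<open>level_decomposition\<close>), a positive root of level \<open>k \<ge> 2\<close> is a sum of \<open>k\<close> roots taken
  from three neighbours \<open>\<theta> (t - 1)\<close>, \<open>\<theta> t\<close>, \<open>\<theta> (t + 1)\<close>, where \<open>t\<close> is an integer nearest to \<open>E / k\<close>. With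
  \<open>E = k t + r\<close>, a sum with multiplicities \<open>Q\<close>, \<open>k - P - Q\<close>, \<open>P\<close> has the right \<open>E\<close> iff \<open>P - Q = r\<close> and
  the right \<open>c\<close> iff \<open>P + Q = T\<close>, where \<open>3 k T = k\<^sup>2 + 3 r\<^sup>2 - 1\<close>; the norm equation makes \<open>T\<close> an integer of
  the parity of \<open>r\<close>, and \<open>\<bar>r\<bar> \<le> k / 2\<close> gives \<open>\<bar>r\<bar> \<le> T \<le> k\<close>. As all positive roots have positive
  height, the summands are lower than the sum, so the roots of level at least 2 are never put into
  the basis.
\<close>

section \<open>Nonnegative combinations\<close>

lemma nonneg_comb_functional:
  fixes L :: "('n::finite) lattice \<Rightarrow> int"
  assumes add: "\<And>x y. L (x + y) = L x + L y" and scale: "\<And>m x. L (m *s x) = m * L x"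
    and nonneg: "\<And>\<gamma>. \<gamma> \<in> S \<Longrightarrow> 0 \<le> L \<gamma>" and x: "x \<in> nonneg_comb S"
  shows "0 \<le> L x"
proof -
  obtain F c where x_eq: "x = (\<Sum>\<gamma>\<in>F. int (c \<gamma>) *s \<gamma>)" and F: "finite F" "F \<subseteq> S"
    using x by (auto simp: nonneg_comb_def)
  have L0: "L 0 = 0"
    using scale[of 0 0] by simp
  have "L (\<Sum>\<gamma>\<in>F. int (c \<gamma>) *s \<gamma>) = (\<Sum>\<gamma>\<in>F. int (c \<gamma>) * L \<gamma>)"
    using F(1) by (induction F rule: finite_induct) (simp_all add: L0 add scale)
  then show ?thesis
    using F(2) nonneg x_eq by (auto intro!: sum_nonneg)
qed

lemma zero_in_nonneg_comb: "0 \<in> nonneg_comb S"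
  by (auto simp: nonneg_comb_def intro!: exI[of _ "{}"])

lemma nonneg_comb_scale:
  assumes "0 \<le> m" and "m = 0 \<or> \<gamma> \<in> S"
  shows "m *s \<gamma> \<in> nonneg_comb S"
proof (cases "m = 0")
  case False
  then have "m *s \<gamma> = (\<Sum>\<delta>\<in>{\<gamma>}. int (nat m) *s \<delta>)" "{\<gamma>} \<subseteq> S"
    using assms by auto
  then show ?thesis
    unfolding nonneg_comb_def mem_Collect_eq by (intro exI[of _ "{\<gamma>}"] exI[of _ "\<lambda>_. nat m"]) simp
qed (simp add: zero_in_nonneg_comb)

lemma nonneg_comb_add:
  assumes "x \<in> nonneg_comb S" "y \<in> nonneg_comb S"
  shows "x + y \<in> nonneg_comb S"
proof -
  obtain F c where x: "x = (\<Sum>\<gamma>\<in>F. int (c \<gamma>) *s \<gamma>)" and F: "finite F" "F \<subseteq> S"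
    using assms(1) by (auto simp: nonneg_comb_def)
  obtain G d where y: "y = (\<Sum>\<gamma>\<in>G. int (d \<gamma>) *s \<gamma>)" and G: "finite G" "G \<subseteq> S"
    using assms(2) by (auto simp: nonneg_comb_def)
  let ?c = "\<lambda>\<gamma>. if \<gamma> \<in> F then c \<gamma> else 0" and ?d = "\<lambda>\<gamma>. if \<gamma> \<in> G then d \<gamma> else 0"
  have "x = (\<Sum>\<gamma>\<in>F \<union> G. int (?c \<gamma>) *s \<gamma>)" "y = (\<Sum>\<gamma>\<in>F \<union> G. int (?d \<gamma>) *s \<gamma>)"
    unfolding x y using F(1) G(1) by (auto intro!: sum.mono_neutral_cong_left)
  then have "x + y = (\<Sum>\<gamma>\<in>F \<union> G. int (?c \<gamma> + ?d \<gamma>) *s \<gamma>)"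
    by (simp add: sum.distrib vector_sadd_rdistrib)
  then show ?thesis
    unfolding nonneg_comb_def mem_Collect_eq using F G
    by (intro exI[of _ "F \<union> G"] exI[of _ "\<lambda>\<gamma>. ?c \<gamma> + ?d \<gamma>"]) simp
qed

lemma nonneg_comb_mono: "S \<subseteq> T \<Longrightarrow> nonneg_comb S \<subseteq> nonneg_comb T"
  unfolding nonneg_comb_def by blast

section \<open>Enumerating a set by a function with finite fibres\<close>

text \<open>
  The elements are numbered fibre by fibre: adding to an arbitrary numbering of each fibre the total
  size of the earlier fibres makes the function \<open>key\<close> below injective on \<open>S\<close> and increasing in \<open>h\<close>.
\<close>

lemma monotone_enumeration:
  fixes h :: "'a \<Rightarrow> nat"
  assumes "infinite S" and fin: "\<And>n. finite {x \<in> S. h x = n}"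
  obtains g :: "nat \<Rightarrow> 'a" where "bij_betw g UNIV S" and "incseq (\<lambda>i. h (g i))"
proof -
  define fibre where "fibre n = {x \<in> S. h x = n}" for n
  have "\<exists>f. bij_betw f (fibre n) {0..<card (fibre n)}" for n
    using ex_bij_betw_finite_nat[OF fin[of n]] by (simp add: fibre_def)
  then obtain f where f: "\<And>n. bij_betw (f n) (fibre n) {0..<card (fibre n)}"
    by metis
  define start where "start n = (\<Sum>j<n. card (fibre j))" for n
  define key where "key x = start (h x) + f (h x) x" for x
  have in_fibre: "f (h x) x < card (fibre (h x))" if "x \<in> S" for x
    using bij_betwE[OF f] that by (auto simp: fibre_def)
  have start_mono: "start m + card (fibre m) \<le> start n" if "m < n" for m n
  proof -
    have "start m + card (fibre m) = start (Suc m)"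
      by (simp add: start_def)
    also have "\<dots> \<le> start n"
      unfolding start_def using that by (intro sum_mono2) auto
    finally show ?thesis .
  qed
  have key_less: "key x < key y" if "x \<in> S" "h x < h y" for x y
    using in_fibre[OF that(1)] start_mono[OF that(2)] by (simp add: key_def)
  have inj: "inj_on key S"
  proof (rule inj_onI)
    fix x y assume xy: "x \<in> S" "y \<in> S" "key x = key y"
    then have h: "h x = h y"
      using key_less[of x y] key_less[of y x] by force
    then have "f (h x) x = f (h x) y" "x \<in> fibre (h x)" "y \<in> fibre (h x)"
      using xy by (auto simp: key_def fibre_def)
    then show "x = y"
      using f by (auto simp: bij_betw_def dest: inj_onD)
  qed
  have "infinite (key ` S)"
    using assms(1) inj by (simp add: finite_image_iff)
  then have enum: "bij_betw (enumerate (key ` S)) UNIV (key ` S)"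
    by (rule bij_enumerate)
  define g where "g = the_inv_into S key \<circ> enumerate (key ` S)"
  have key_g: "key (g i) = enumerate (key ` S) i" for i
    unfolding g_def using inj bij_betwE[OF enum] by (auto intro!: f_the_inv_into_f)
  have bij: "bij_betw g UNIV S"
    unfolding g_def
    by (rule bij_betw_trans[OF enum]) (rule bij_betw_the_inv_into[OF inj_on_imp_bij_betw[OF inj]])
  have "h (g i) \<le> h (g k)" if "i \<le> k" for i k
  proof (rule ccontr)
    assume "\<not> h (g i) \<le> h (g k)"
    then have "key (g k) < key (g i)"
      using bij by (intro key_less) (auto simp: bij_betw_def)
    then show False
      using that \<open>infinite (key ` S)\<close> by (simp add: key_g not_less[symmetric])
  qed
  then have "incseq (\<lambda>i. h (g i))"
    by (simp add: incseq_def)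
  with bij show thesis
    by (rule that)
qed

section \<open>Real roots\<close>

lemma real_roots_fund_root: "fund_root i \<in> real_roots A"
  unfolding real_roots_def using weyl_id[of A] by (auto intro!: exI[of _ id] exI[of _ i])

lemma real_roots_reflection: "x \<in> real_roots A \<Longrightarrow> fund_reflection A i x \<in> real_roots A"
  unfolding real_roots_def using weyl_step[of _ A i] by (auto intro: comp_apply[symmetric])

lemma real_roots_induct [consumes 1, case_names fund_root reflection]:
  assumes "x \<in> real_roots A"
    and fund: "\<And>i. P (fund_root i)"
    and refl: "\<And>x i. x \<in> real_roots A \<Longrightarrow> P x \<Longrightarrow> P (fund_reflection A i x)"
  shows "P x"
proof -
  obtain w i where x: "x = w (fund_root i)" and "w \<in> weyl_group A"
    using assms(1) by (auto simp: real_roots_def)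
  from this(2) have "w (fund_root i) \<in> real_roots A \<and> P (w (fund_root i))"
    by induction (auto simp: fund refl real_roots_fund_root real_roots_reflection)
  then show ?thesis
    by (simp add: x)
qed

lemma coroot_pairing_minus: "coroot_pairing A (- x) i = - coroot_pairing A x i"
  by (simp add: coroot_pairing_def sum_negf)

lemma real_roots_uminus:
  assumes "\<And>i. A $ i $ i = 2" and "x \<in> real_roots A"
  shows "- x \<in> real_roots A"
  using assms(2)
proof (induction rule: real_roots_induct)
  case (fund_root i)
  have "coroot_pairing A (fund_root i) i = 2"
    using assms(1) by (simp add: coroot_pairing_def fund_root_def axis_def if_distrib cong: if_cong)
  then have "- fund_root i = fund_reflection A i (fund_root i)"
    by (simp add: fund_reflection_def vec_eq_iff)
  then show ?case
    by (simp add: real_roots_fund_root real_roots_reflection)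
next
  case (reflection x i)
  have "- fund_reflection A i x = fund_reflection A i (- x)"
    by (simp add: fund_reflection_def coroot_pairing_minus vec_eq_iff)
  then show ?case
    using reflection by (simp add: real_roots_reflection)
qed

lemma fund_root_nth: "fund_root i $ j = (if j = i then 1 else 0)"
  by (simp add: fund_root_def axis_def)

lemma cartan_pairing:
  "coroot_pairing cartan x 1 = 2 * x $ 1 - x $ 2 - x $ 3 - x $ 4"
  "coroot_pairing cartan x 2 = 2 * x $ 2 - x $ 1 - x $ 3"
  "coroot_pairing cartan x 3 = 2 * x $ 3 - x $ 1 - x $ 2"
  "coroot_pairing cartan x 4 = 2 * x $ 4 - x $ 1"
  by (simp_all add: coroot_pairing_def sum_4 cartan_def simply_laced_matrix_def doubleton_eq_iff)

lemma cartan_diag: "cartan $ i $ i = 2"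
  by (simp add: cartan_def simply_laced_matrix_def)

lemma lattice_eqI:
  fixes x y :: "4 lattice"
  assumes "x $ 1 = y $ 1" "x $ 2 = y $ 2" "x $ 3 = y $ 3" "x $ 4 = y $ 4"
  shows "x = y"
  using assms by (simp add: vec_eq_iff forall_4)

text \<open>
  The values are half those of the invariant quadratic form \<open>(x, x)\<close>; integrality makes this
  version the more convenient one.
\<close>

definition half_norm :: "4 lattice \<Rightarrow> int" where
  "half_norm x = (x $ 1)\<^sup>2 + (x $ 2)\<^sup>2 + (x $ 3)\<^sup>2 + (x $ 4)\<^sup>2
     - x $ 1 * x $ 2 - x $ 1 * x $ 3 - x $ 2 * x $ 3 - x $ 1 * x $ 4"

lemma half_norm_reflection: "half_norm (fund_reflection cartan i x) = half_norm x"
  using exhaust_4[of i]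
  by (elim disjE)
     (simp_all add: half_norm_def fund_reflection_def cartan_pairing fund_root_nth
       power2_eq_square algebra_simps)

lemma half_norm_real_root: "x \<in> real_roots cartan \<Longrightarrow> half_norm x = 1"
proof (induction rule: real_roots_induct)
  case (fund_root i)
  then show ?case
    using exhaust_4[of i] by (elim disjE) (simp_all add: half_norm_def fund_root_nth)
qed (simp add: half_norm_reflection)

section \<open>The real roots in $Z_s(\alpha_4)$\<close>

lemma real_root_in_Zs_set_iff:
  assumes x: "x \<in> real_roots cartan"
  shows "x \<in> Zs_set cartan (\<alpha> 4) \<longleftrightarrow> x $ 1 = 2 * x $ 4"
proof
  have Z: "0 \<le> coroot_pairing cartan y 4" if "y \<in> Z_set cartan (\<alpha> 4)" "y \<in> real_roots cartan" for y
  proof (rule ccontr)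
    assume neg: "\<not> ?thesis"
    let ?m = "coroot_pairing cartan y 4"
    have "fund_reflection cartan 4 y = - ?m *s \<alpha> 4 + 1 *s y"
      by (simp add: fund_reflection_def vec_eq_iff)
    moreover have "0 < - ?m" "0 < (1::int)"
      using neg by simp_all
    ultimately have "fund_reflection cartan 4 y \<in> C_set cartan (\<alpha> 4) y"
      unfolding C_set_def using real_roots_reflection[OF that(2)] by blast
    then show False
      using that(1) by (simp add: Z_set_def)
  qed
  have minus: "- x \<in> real_roots cartan"
    using cartan_diag x by (rule real_roots_uminus)
  {
    assume "x \<in> Zs_set cartan (\<alpha> 4)"
    then have "x \<in> Z_set cartan (\<alpha> 4)" "- x \<in> Z_set cartan (\<alpha> 4)"
      by (auto simp: Zs_set_def)
    then have "coroot_pairing cartan x 4 = 0"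
      using Z[OF _ x] Z[OF _ minus] by (simp add: coroot_pairing_minus)
    then show "x $ 1 = 2 * x $ 4"
      by (simp add: cartan_pairing)
  next
    assume orth: "x $ 1 = 2 * x $ 4"
    have "y \<in> Z_set cartan (\<alpha> 4)"
      if y: "y \<in> real_roots cartan" and orth: "y $ 1 = 2 * y $ 4" for y
    proof -
      have False if pq: "0 < p" "0 < q" and real: "p *s \<alpha> 4 + q *s y \<in> real_roots cartan" for p q
      proof -
        have "p\<^sup>2 + q\<^sup>2 * half_norm y = half_norm (p *s \<alpha> 4 + q *s y)"
          by (simp add: half_norm_def fund_root_nth orth power2_eq_square algebra_simps)
        then have "p\<^sup>2 + q\<^sup>2 = 1"
          using half_norm_real_root[OF real] half_norm_real_root[OF y] by simp
        moreover have "1 \<le> p\<^sup>2" "1 \<le> q\<^sup>2"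
          using pq by (simp_all add: one_le_power)
        ultimately show False by simp
      qed
      then show ?thesis
        using y by (auto simp: Z_set_def C_set_def roots_def)
    qed
    from this[OF x orth] this[OF minus] orth show "x \<in> Zs_set cartan (\<alpha> 4)"
      by (auto simp: Zs_set_def intro!: image_eqI[of x uminus "- x"])
  }
qed

section \<open>The roots of level one\<close>

text \<open>
  Tuples of coordinates let a long word in the reflections be evaluated one letter at a time,
  with normalized polynomial entries at each stage.
\<close>

definition quad :: "int \<Rightarrow> int \<Rightarrow> int \<Rightarrow> int \<Rightarrow> 4 lattice" where
  "quad a b c d = a *s \<alpha> 1 + b *s \<alpha> 2 + c *s \<alpha> 3 + d *s \<alpha> 4"

lemma quad_nth: "quad a b c d $ 1 = a" "quad a b c d $ 2 = b" "quad a b c d $ 3 = c" "quad a b c d $ 4 = d"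
  by (simp_all add: quad_def fund_root_nth)

lemma reflection_quad:
  "fund_reflection cartan 1 (quad a b c d) = quad (b + c + d - a) b c d"
  "fund_reflection cartan 2 (quad a b c d) = quad a (a + c - b) c d"
  "fund_reflection cartan 3 (quad a b c d) = quad a b (a + b - c) d"
  "fund_reflection cartan 4 (quad a b c d) = quad a b c (a - d)"
  by (auto intro!: lattice_eqI simp: fund_reflection_def cartan_pairing fund_root_nth quad_nth)

definition \<theta> :: "int \<Rightarrow> 4 lattice" where
  "\<theta> e = quad (6 * e * (e + 1)) ((e + 1) * (3 * e + 1)) (e * (3 * e + 2)) (3 * e * (e + 1))"

lemma \<theta>_nth:
  "\<theta> e $ 1 = 6 * e * (e + 1)" "\<theta> e $ 2 = (e + 1) * (3 * e + 1)"
  "\<theta> e $ 3 = e * (3 * e + 2)" "\<theta> e $ 4 = 3 * e * (e + 1)"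
  by (simp_all add: \<theta>_def quad_nth)

lemma \<beta>'_eq: "\<beta>' n = \<theta> (int n)"
  by (rule lattice_eqI) (simp_all add: \<beta>'_def \<theta>_nth fund_root_nth algebra_simps)

lemma \<beta>_eq: "\<beta> n = \<theta> (- int n - 1)"
  by (rule lattice_eqI) (simp_all add: \<beta>_def \<theta>_nth fund_root_nth algebra_simps)

lemma inj_\<theta>: "inj \<theta>"
proof (rule injI)
  fix e f assume "\<theta> e = \<theta> f"
  then have "\<theta> e $ 4 - \<theta> e $ 3 = \<theta> f $ 4 - \<theta> f $ 3" by simp
  then show "e = f" by (simp add: \<theta>_nth algebra_simps)
qed

lemma range_\<theta>: "range \<beta> \<union> range \<beta>' = range \<theta>"
proof -
  have "\<theta> e \<in> range \<beta> \<union> range \<beta>'" for e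
  proof (cases "0 \<le> e")
    case True
    then have "\<theta> e = \<beta>' (nat e)" by (simp add: \<beta>'_eq)
    then show ?thesis by blast
  next
    case False
    then have "\<theta> e = \<beta> (nat (- e - 1))" by (simp add: \<beta>_eq)
    then show ?thesis by blast
  qed
  then show ?thesis by (auto simp: \<beta>_eq \<beta>'_eq)
qed

text \<open>
  The word represents the element of the Weyl group that fixes \<open>\<alpha>\<^sub>4\<close> and the null vector
  \<open>2 \<alpha>\<^sub>1 + \<alpha>\<^sub>2 + \<alpha>\<^sub>3 + \<alpha>\<^sub>4\<close> and translates the parabola of level 1 roots by one step. It can be found by
  a search for an element taking \<open>\<theta> (-1)\<close>, \<open>\<theta> 0\<close>, \<open>\<theta> 1\<close>, \<open>\<alpha>\<^sub>4\<close> to \<open>\<theta> 0\<close>, \<open>\<theta> 1\<close>, \<open>\<theta> 2\<close>, \<open>\<alpha>\<^sub>4\<close>. The second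
  identity uses the reversed word.
\<close>

lemma \<theta>_translation:
  defines "s \<equiv> fund_reflection cartan"
  shows "s 1 (s 2 (s 4 (s 1 (s 3 (s 2 (s 1 (s 3 (s 4 (s 1 (\<theta> e)))))))))) = \<theta> (e + 1)"
    and "s 1 (s 4 (s 3 (s 1 (s 2 (s 3 (s 1 (s 4 (s 2 (s 1 (\<theta> (e + 1))))))))))) = \<theta> e"
  unfolding s_def \<theta>_def
  by (simp_all add: reflection_quad algebra_simps)

lemma real_root_\<theta>: "\<theta> e \<in> real_roots cartan"
proof (induction e rule: int_induct[where k = 0])
  case base
  have "\<theta> 0 = \<alpha> 2" by (simp add: \<theta>_def quad_def)
  then show ?case by (simp add: real_roots_fund_root)
next
  case (step1 e)
  then show ?case by (subst \<theta>_translation(1)[symmetric]) (intro real_roots_reflection)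
next
  case (step2 e)
  then show ?case
    using \<theta>_translation(2)[of "e - 1"] by (metis diff_add_cancel real_roots_reflection)
qed

section \<open>Coordinates and the norm equation\<close>

definition Zs_pos_roots :: "4 lattice set" where
  "Zs_pos_roots = pos_real_roots_of cartan (Zs_set cartan (\<alpha> 4))"

text \<open>
  This is the pairing with the null vector
  \<open>- (2 \<alpha>\<^sub>1 + \<alpha>\<^sub>2 + \<alpha>\<^sub>3 + \<alpha>\<^sub>4)\<close>, and so is invariant under the translation above.
\<close>

definition level :: "4 lattice \<Rightarrow> int" where
  "level x = x $ 2 + x $ 3 - x $ 1"

lemma Zs_pos_rootsD:
  assumes "x \<in> Zs_pos_roots"
  shows "x $ 1 = 2 * x $ 4" and "half_norm x = 1" and "0 \<le> x $ i"
  using assms real_root_in_Zs_set_iff half_norm_real_root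
  by (auto simp: Zs_pos_roots_def pos_real_roots_of_def)

lemma \<theta>_in_Zs_pos_roots: "\<theta> e \<in> Zs_pos_roots"
proof -
  have sgn: "0 \<le> e \<or> e \<le> - 1" by linarith
  have "0 \<le> e * (e + 1)" "0 \<le> (e + 1) * (3 * e + 1)" "0 \<le> e * (3 * e + 2)"
    using sgn by (auto simp: zero_le_mult_iff)
  then have "0 \<le> \<theta> e $ i" for i
    using exhaust_4[of i] by (auto simp: \<theta>_nth mult.assoc)
  moreover have "\<theta> e $ 1 = 2 * \<theta> e $ 4"
    by (simp add: \<theta>_nth)
  ultimately show ?thesis
    using real_root_\<theta>[of e] by (simp add: Zs_pos_roots_def pos_real_roots_of_def real_root_in_Zs_set_iff)
qed

lemma nth_2_eq:
  assumes "x $ 1 = 2 * x $ 4"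
  shows "x $ 2 = level x + x $ 4 + (x $ 4 - x $ 3)"
  using assms by (simp add: level_def)

lemma norm_equation:
  assumes "x \<in> Zs_pos_roots"
  defines "k \<equiv> level x" and "E \<equiv> x $ 4 - x $ 3"
  shows "k * (x $ 4 - k - 3 * E) = 3 * E\<^sup>2 - 1"
  using Zs_pos_rootsD(2)[OF assms(1)]
  by (simp add: k_def E_def half_norm_def level_def Zs_pos_rootsD(1)[OF assms(1)]
      power2_eq_square algebra_simps)

text \<open>
  A root of negative level \<open>k\<close> with nonnegative coordinates has \<open>c \<ge> 1\<close>, so that \<open>k c \<le> -1\<close>; but
  \<open>4 (k c + 1) = k\<^sup>2 + 3 (k + 2 E)\<^sup>2\<close> by the norm equation. Level 0 would give \<open>3 E\<^sup>2 = 1\<close>.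
\<close>

lemma level_pos:
  assumes x: "x \<in> Zs_pos_roots"
  shows "0 < level x"
proof (rule ccontr)
  define k E c where "k = level x" and "E = x $ 4 - x $ 3" and "c = x $ 4"
  assume "\<not> 0 < level x"
  then have "k \<le> 0" by (simp add: k_def)
  have eq: "k * (c - k - 3 * E) = 3 * E\<^sup>2 - 1"
    using norm_equation[OF x] by (simp add: k_def E_def c_def)
  have "k \<noteq> 0"
  proof
    assume "k = 0"
    then have "3 * E\<^sup>2 = 1" using eq by simp
    then show False by presburger
  qed
  moreover have "0 \<le> k + 2 * c"
    using Zs_pos_rootsD(3)[OF x, of 2] Zs_pos_rootsD(3)[OF x, of 3] Zs_pos_rootsD(1)[OF x]
    by (simp add: k_def c_def level_def)
  ultimately have "k \<le> - 1" "1 \<le> c"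
    using \<open>k \<le> 0\<close> by linarith+
  then have "k * c \<le> - 1 * 1"
    using mult_mono[of 1 "- k" 1 c] by simp
  moreover have "4 * (k * c + 1) = k\<^sup>2 + 3 * (k + 2 * E)\<^sup>2"
    using eq by (simp add: power2_eq_square algebra_simps)
  moreover have "0 \<le> 3 * (k + 2 * E)\<^sup>2"
    by simp
  ultimately have "k\<^sup>2 \<le> 0"
    by (smt (verit))
  then show False using \<open>k \<noteq> 0\<close> by simp
qed

lemma level_one:
  assumes x: "x \<in> Zs_pos_roots" and "level x = 1"
  shows "x = \<theta> (x $ 4 - x $ 3)"
proof -
  define E where "E = x $ 4 - x $ 3"
  have "x $ 4 = 3 * E * (E + 1)" "x $ 3 = x $ 4 - E"
    using norm_equation[OF x] assms(2) by (simp_all add: E_def[symmetric] power2_eq_square algebra_simps)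
      (simp add: E_def)
  then show ?thesis
    unfolding E_def[symmetric]
    using Zs_pos_rootsD(1)[OF x] nth_2_eq[of x] assms(2)
    by (intro lattice_eqI) (simp_all add: \<theta>_nth algebra_simps)
qed

section \<open>Separating a root of level one from the others\<close>

text \<open>
  On vectors orthogonal to \<open>\<alpha>\<^sub>4\<close> this is \<open>level x - (\<theta> e, x)\<close>, the level of the reflection of \<open>x\<close> in
  \<open>\<theta> e\<close>. Its nonnegativity expresses that a simple reflection makes only one positive root negative.
\<close>

definition separator :: "int \<Rightarrow> 4 lattice \<Rightarrow> int" where
  "separator e x = (3 * e\<^sup>2 - 1) * level x - (6 * e + 3) * (x $ 4 - x $ 3) + x $ 4"

lemma separator_\<theta>: "separator e (\<theta> e) = - 1"
  by (simp add: separator_def level_def \<theta>_nth power2_eq_square algebra_simps)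

text \<open>
  Multiplying by the level \<open>k\<close> turns the separator into \<open>3 (E - k e)\<^sup>2 - 1\<close>, which is negative only
  if \<open>E = k e\<close>; then \<open>k\<close> divides 1, and the root is \<open>\<theta> e\<close> itself.
\<close>

lemma separator_nonneg:
  assumes x: "x \<in> Zs_pos_roots" and "x \<noteq> \<theta> e"
  shows "0 \<le> separator e x"
proof -
  define k E where "k = level x" and "E = x $ 4 - x $ 3"
  have "0 < k" using level_pos[OF x] by (simp add: k_def)
  have eq: "k * (x $ 4 - k - 3 * E) = 3 * E\<^sup>2 - 1"
    using norm_equation[OF x] by (simp add: k_def E_def)
  then have sep: "k * separator e x = 3 * (E - k * e)\<^sup>2 - 1"
    by (simp add: separator_def k_def[symmetric] E_def[symmetric] power2_eq_square algebra_simps)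
  show ?thesis
  proof (cases "E = k * e")
    case True
    then have "k dvd 1"
      using sep by (metis dvd_triv_left dvd_minus_iff diff_0 diff_self mult_zero_right zero_power2)
    then have "k = 1" using \<open>0 < k\<close> by simp
    then show ?thesis
      using level_one[OF x] assms(2) True by (simp add: k_def E_def)
  next
    case False
    then have "0 \<le> k * separator e x"
      unfolding sep using zero_less_power2[of "E - k * e"] by simp
    then show ?thesis
      using \<open>0 < k\<close> by (simp add: zero_le_mult_iff)
  qed
qed

lemma level_linear: "level (x + y) = level x + level y" "level (m *s x) = m * level x"
  by (simp_all add: level_def algebra_simps)

lemma separator_linear:
  "separator e (x + y) = separator e x + separator e y" "separator e (m *s x) = m * separator e x"
  by (simp_all add: separator_def level_linear algebra_simps)

text \<open>
  The separator excludes positive multiples and the level excludes negative ones.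
\<close>

lemma \<theta>_multiple_notin:
  assumes S: "S \<subseteq> Zs_pos_roots - {\<theta> e}" and "m \<noteq> 0"
  shows "m *s \<theta> e \<notin> nonneg_comb S"
proof
  assume comb: "m *s \<theta> e \<in> nonneg_comb S"
  have "0 \<le> separator e \<gamma>" "0 \<le> level \<gamma>" if "\<gamma> \<in> S" for \<gamma>
    using S separator_nonneg level_pos that by (auto simp: less_imp_le)
  then have "0 \<le> separator e (m *s \<theta> e)" "0 \<le> level (m *s \<theta> e)"
    using nonneg_comb_functional[where L = "separator e", OF separator_linear _ comb]
      nonneg_comb_functional[where L = level, OF level_linear _ comb] by blast+
  moreover have "level (\<theta> e) = 1"
    by (simp add: level_def \<theta>_nth algebra_simps)
  ultimately show False
    using \<open>m \<noteq> 0\<close> by (simp add: separator_linear level_linear separator_\<theta>)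
qed

section \<open>Decomposing the roots of higher level\<close>

text \<open>
  These are the conditions for \<open>(T + r) / 2\<close>, \<open>(T - r) / 2\<close> and \<open>k - T\<close> to be multiplicities. The parity
  is clear for odd \<open>k\<close>; for even \<open>k\<close> the equation makes \<open>r\<close> odd, and modulo 4 it then excludes an even
  \<open>T\<close>. The lower bound is \<open>(k - 2 \<bar>r\<bar>) (k - \<bar>r\<bar>) + r\<^sup>2 - 1 \<ge> 0\<close>.
\<close>

lemma multiplicity_bounds:
  fixes k r T :: int
  assumes k: "2 \<le> k" and r: "\<bar>2 * r\<bar> \<le> k" and T: "3 * (k * T) = k\<^sup>2 + 3 * r\<^sup>2 - 1"
  shows "even (T + r)" and "\<bar>r\<bar> \<le> T" and "T \<le> k"
proof -
  show "even (T + r)"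
  proof (rule ccontr)
    assume odd: "odd (T + r)"
    show False
    proof (cases "even k")
      case True
      then have "even (3 * r\<^sup>2 - 1)"
        using arg_cong[OF T, of even] by simp
      then have "odd r" by auto
      then have "even T" using odd by simp
      obtain k' T' r' where "k = 2 * k'" "T = 2 * T'" "r = 2 * r' + 1"
        using \<open>even k\<close> \<open>even T\<close> \<open>odd r\<close> by (auto elim!: evenE oddE)
      then have "4 * (3 * k' * T' - k'\<^sup>2 - 3 * r'\<^sup>2 - 3 * r') = 2"
        using T by (simp add: power2_eq_square algebra_simps)
      then show False by presburger
    next
      case False
      then show False
        using arg_cong[OF T, of even] odd by auto
    qed
  qed
  have "0 \<le> (k - 2 * \<bar>r\<bar>) * (k - \<bar>r\<bar>) + (r\<^sup>2 - 1)"
  proof (cases "r = 0")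
    case True
    then show ?thesis using k mult_mono[of 1 k 1 k] by (simp add: power2_eq_square)
  next
    case False
    then have "1 \<le> r\<^sup>2" using zero_less_power2[of r] by linarith
    moreover have "0 \<le> (k - 2 * \<bar>r\<bar>) * (k - \<bar>r\<bar>)"
      using r k by (intro mult_nonneg_nonneg) auto
    ultimately show ?thesis by simp
  qed
  also have "\<dots> = 3 * (k * T) - 3 * (k * \<bar>r\<bar>)"
    unfolding T by (simp add: power2_eq_square algebra_simps)
  finally have "k * \<bar>r\<bar> \<le> k * T" by simp
  then show "\<bar>r\<bar> \<le> T" using k by simp
  have "4 * r\<^sup>2 \<le> k\<^sup>2"
    using r k abs_le_square_iff[of "2 * r" k] by (simp add: power_mult_distrib)
  moreover have "0 \<le> k\<^sup>2"
    by simp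
  ultimately have "3 * (k * T) \<le> 3 * k\<^sup>2"
    unfolding T by linarith
  then have "k * T \<le> k * k" by (simp add: power2_eq_square)
  then show "T \<le> k" using k by simp
qed

lemma level_decomposition:
  assumes x: "x \<in> Zs_pos_roots" and level: "2 \<le> level x"
  obtains t P Q R where "x = P *s \<theta> (t + 1) + Q *s \<theta> (t - 1) + R *s \<theta> t"
    and "0 \<le> P" "0 \<le> Q" "0 \<le> R" "P + Q + R = level x"
proof -
  define k E c where "k = level x" and "E = x $ 4 - x $ 3" and "c = x $ 4"
  have k: "2 \<le> k" using level by (simp add: k_def)
  have eq: "k * (c - k - 3 * E) = 3 * E\<^sup>2 - 1"
    using norm_equation[OF x] by (simp add: k_def E_def c_def)
  \<comment> \<open>rounding \<open>E / k\<close> to a nearest integer\<close>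
  define t where "t = (2 * E + k) div (2 * k)"
  define r where "r = E - k * t"
  have "(2 * E + k) mod (2 * k) = 2 * r + k"
    unfolding r_def t_def by (simp add: minus_mult_div_eq_mod[symmetric] algebra_simps)
  then have "0 \<le> 2 * r + k" "2 * r + k < 2 * k"
    using k pos_mod_bound[of "2 * k" "2 * E + k"] pos_mod_sign[of "2 * k" "2 * E + k"] by auto
  then have r: "\<bar>2 * r\<bar> \<le> k" by linarith
  \<comment> \<open>The norm equation reads \<open>k c = k\<^sup>2 - 1\<close> modulo 3, so 3 does not divide \<open>k\<close>, hence divides \<open>k\<^sup>2 - 1\<close>.\<close>
  have "3 dvd c"
  proof -
    define m where "m = k * E + E * E"
    have kc: "k * c = k * k - 1 + 3 * m"
      using eq by (simp add: m_def power2_eq_square algebra_simps)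
    have "\<exists>a. k = 3 * a \<or> k = 3 * a + 1 \<or> k = 3 * a + 2"
      by presburger
    then consider a where "k = 3 * a" | a where "k = 3 * a + 1" | a where "k = 3 * a + 2" by blast
    then show ?thesis
    proof cases
      case 1
      then have "3 * (a * c - 3 * a * a - m) = - 1"
        using kc by (simp add: algebra_simps)
      then show ?thesis by presburger
    next
      case 2
      then have "c = 3 * (3 * a * a + 2 * a + m - a * c)"
        using kc by (simp add: algebra_simps)
      then show ?thesis by (metis dvd_triv_left)
    next
      case 3
      then have "c = 3 * (c - (3 * a * a + 4 * a + 1 + m - a * c))"
        using kc by (simp add: algebra_simps)
      then show ?thesis by (metis dvd_triv_left)
    qed
  qed
  then obtain c' where c': "c = 3 * c'" by blast
  define T where "T = c' - E - k * t\<^sup>2 - 2 * t * r"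
  have E: "E = k * t + r" by (simp add: r_def)
  have T: "3 * (k * T) = k\<^sup>2 + 3 * r\<^sup>2 - 1"
    using eq unfolding T_def c' E by (simp add: power2_eq_square algebra_simps)
  note adj = multiplicity_bounds[OF k r T]
  then obtain P where P: "T + r = 2 * P" by blast
  define Q R where "Q = T - P" and "R = k - T"
  have PQ: "r = P - Q" "T = P + Q" using P by (simp_all add: Q_def)
  have c: "c = 3 * (P + Q + k * t + r + k * t\<^sup>2 + 2 * t * r)"
    using PQ(2) unfolding c' T_def E by simp
  have kR: "k = P + Q + R" by (simp add: R_def PQ(2))
  have x3: "x $ 3 = c - E" and x2: "x $ 2 = k + c + E" and x1: "x $ 1 = 2 * c" and x4: "x $ 4 = c"
    using nth_2_eq[of x] Zs_pos_rootsD(1)[OF x] by (simp_all add: k_def c_def E_def)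
  have "x = P *s \<theta> (t + 1) + Q *s \<theta> (t - 1) + R *s \<theta> t"
    by (rule lattice_eqI)
       (simp_all only: x1 x2 x3 x4 E c kR PQ(1) vector_add_component vector_smult_component \<theta>_nth,
        simp_all add: power2_eq_square algebra_simps)
  moreover have "0 \<le> P" "0 \<le> Q" "0 \<le> R" "P + Q + R = level x"
    using adj PQ by (auto simp: R_def k_def)
  ultimately show thesis using that by blast
qed

lemma height_eq: "height (x :: 4 lattice) = x $ 1 + x $ 2 + x $ 3 + x $ 4"
  by (simp add: height_def sum_4)

lemma height_linear: "height (x + y :: 4 lattice) = height x + height y"
  "height (m *s x :: 4 lattice) = m * height x"
  by (simp_all add: height_eq algebra_simps)

lemma height_pos_root:
  assumes "x \<in> Zs_pos_roots"
  shows "0 < height x"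
  using Zs_pos_rootsD(1)[OF assms] Zs_pos_rootsD(3)[OF assms, of 4] level_pos[OF assms]
  by (simp add: height_eq level_def)

text \<open>
  Since there are at least two summands and all heights are positive, each summand that occurs is
  strictly lower than the sum.
\<close>

lemma in_comb_of_lower_\<theta>:
  assumes x: "x \<in> Zs_pos_roots" and level: "2 \<le> level x"
  shows "x \<in> nonneg_comb {\<gamma> \<in> range \<theta>. height \<gamma> < height x}"
proof -
  obtain t P Q R where eq: "x = P *s \<theta> (t + 1) + Q *s \<theta> (t - 1) + R *s \<theta> t"
    and PQR: "0 \<le> P" "0 \<le> Q" "0 \<le> R" "P + Q + R = level x"
    using level_decomposition[OF assms] .
  have ht: "height x = P * height (\<theta> (t + 1)) + Q * height (\<theta> (t - 1)) + R * height (\<theta> t)"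
    unfolding eq by (simp add: height_linear)
  have pos: "1 \<le> height (\<theta> e)" for e
    using height_pos_root[OF \<theta>_in_Zs_pos_roots[of e]] by simp
  have lower: "p = 0 \<or> h < p * h + q * h' + r * h''"
    if "0 \<le> p" "0 \<le> q" "0 \<le> r" "2 \<le> p + q + r" "1 \<le> h" "1 \<le> h'" "1 \<le> h''"
    for p q r h h' h'' :: int
  proof (cases "p = 0")
    case False
    then have "(p - 1) * 1 \<le> (p - 1) * h" "q * 1 \<le> q * h'" "r * 1 \<le> r * h''"
      using that by (intro mult_left_mono; simp)+
    then show ?thesis using that by (simp add: algebra_simps)
  qed simp
  have "P = 0 \<or> height (\<theta> (t + 1)) < height x" "Q = 0 \<or> height (\<theta> (t - 1)) < height x"
    "R = 0 \<or> height (\<theta> t) < height x"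
    using lower[of P Q R "height (\<theta> (t + 1))" "height (\<theta> (t - 1))" "height (\<theta> t)"]
      lower[of Q P R "height (\<theta> (t - 1))" "height (\<theta> (t + 1))" "height (\<theta> t)"]
      lower[of R P Q "height (\<theta> t)" "height (\<theta> (t + 1))" "height (\<theta> (t - 1))"]
      PQR level pos unfolding ht by (simp_all add: ac_simps)
  then have "P *s \<theta> (t + 1) + Q *s \<theta> (t - 1) + R *s \<theta> t
      \<in> nonneg_comb {\<gamma> \<in> range \<theta>. height \<gamma> < height x}"
    using PQR by (intro nonneg_comb_add nonneg_comb_scale) auto
  then show ?thesis
    using eq by simp
qed

lemma finite_height_fibre: "finite {x \<in> Zs_pos_roots. nat (height x) = n}"
proof (rule finite_subset)
  show "{x \<in> Zs_pos_roots. nat (height x) = n} \<subseteq> vec_lambda ` (UNIV \<rightarrow>\<^sub>E {0..int n})"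
  proof
    fix x assume "x \<in> {x \<in> Zs_pos_roots. nat (height x) = n}"
    then have "x $ 1 + x $ 2 + x $ 3 + x $ 4 \<le> int n" "\<And>i. 0 \<le> x $ i"
      using Zs_pos_rootsD(3) by (auto simp: height_eq)
    then have "\<forall>i. x $ i \<in> {0..int n}"
      unfolding forall_4 atLeastAtMost_iff by (smt (verit))
    then show "x \<in> vec_lambda ` (UNIV \<rightarrow>\<^sub>E {0..int n})"
      by (intro image_eqI[of _ _ "vec_nth x"]) (auto simp: PiE_def)
  qed
  show "finite (vec_lambda ` (UNIV \<rightarrow>\<^sub>E {0..int n}) :: 4 lattice set)"
    by (intro finite_imageI finite_PiE) auto
qed

section \<open>The weak basis\<close>

lemma height_listing_exists: "\<exists>I g. height_listing cartan (Zs_set cartan (\<alpha> 4)) I g"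
proof -
  have "infinite (range \<theta>)"
    using inj_\<theta> by (simp add: finite_image_iff)
  then have "infinite Zs_pos_roots"
    using \<theta>_in_Zs_pos_roots by (meson finite_subset image_subsetI)
  obtain g where g: "bij_betw g UNIV Zs_pos_roots"
    and mono: "incseq (\<lambda>i. nat (height (g i)))"
    using monotone_enumeration[OF \<open>infinite Zs_pos_roots\<close> finite_height_fibre] .
  have "height (g i) \<le> height (g k)" if "i \<le> k" for i k
  proof -
    have "0 < height (g k)"
      using bij_betwE[OF g] by (simp add: height_pos_root)
    then show ?thesis
      using incseqD[OF mono that] by (simp add: nat_le_eq_zle)
  qed
  then have "height_listing cartan (Zs_set cartan (\<alpha> 4)) UNIV g"
    using g by (simp add: height_listing_def Zs_pos_roots_def)
  then show ?thesis by blast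
qed

text \<open>
  In any listing, \<open>\<theta> e\<close> survives because it is not a combination of other positive roots of \<open>Z\<^sub>s(\<alpha>\<^sub>4)\<close>, earlier
  or not; a root of higher level is discarded because its strictly lower summands precede it, however
  ties in height are broken.
\<close>

lemma weak_basis_\<theta>: "is_weak_basis cartan (Zs_set cartan (\<alpha> 4)) (range \<theta>)"
  unfolding is_weak_basis_def
proof (intro conjI allI impI height_listing_exists)
  fix I g assume "height_listing cartan (Zs_set cartan (\<alpha> 4)) I g"
  then have down: "\<And>i k. k \<in> I \<Longrightarrow> i < k \<Longrightarrow> i \<in> I" and bij: "bij_betw g I Zs_pos_roots"
    and mono: "\<And>i k. i \<in> I \<Longrightarrow> k \<in> I \<Longrightarrow> i \<le> k \<Longrightarrow> height (g i) \<le> height (g k)"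
    by (auto simp: height_listing_def Zs_pos_roots_def)
  show "range \<theta> = {g k | k. k \<in> I \<and> g k \<notin> nonneg_comb (g ` {..<k})}"
  proof (intro equalityI subsetI)
    fix x assume "x \<in> range \<theta>"
    then obtain e where e: "x = \<theta> e" by blast
    obtain k where k: "k \<in> I" "g k = \<theta> e"
      using bij \<theta>_in_Zs_pos_roots[of e] by (metis bij_betw_iff_bijections)
    have "g i \<in> Zs_pos_roots - {\<theta> e}" if "i < k" for i
      using down[OF k(1) that] k that bij by (metis Diff_iff bij_betwE bij_betw_inv_into_left nat_neq_iff singletonD)
    then have "1 *s \<theta> e \<notin> nonneg_comb (g ` {..<k})"
      by (intro \<theta>_multiple_notin) auto
    then show "x \<in> {g k | k. k \<in> I \<and> g k \<notin> nonneg_comb (g ` {..<k})}"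
      using k e by (auto intro!: exI[of _ k])
  next
    fix x assume "x \<in> {g k | k. k \<in> I \<and> g k \<notin> nonneg_comb (g ` {..<k})}"
    then obtain k where k: "k \<in> I" "x = g k" and notin: "g k \<notin> nonneg_comb (g ` {..<k})"
      by blast
    have x: "x \<in> Zs_pos_roots"
      using bij k by (auto simp: bij_betw_def)
    have "{\<gamma> \<in> range \<theta>. height \<gamma> < height x} \<subseteq> g ` {..<k}"
    proof
      fix \<gamma> assume "\<gamma> \<in> {\<gamma> \<in> range \<theta>. height \<gamma> < height x}"
      then have "\<gamma> \<in> Zs_pos_roots" and less: "height \<gamma> < height x"
        using \<theta>_in_Zs_pos_roots by auto
      then obtain i where i: "i \<in> I" "\<gamma> = g i"
        using bij by (auto simp: bij_betw_def)
      then have "i < k"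
        using mono[OF k(1) i(1)] less k(2) by (meson not_le)
      then show "\<gamma> \<in> g ` {..<k}"
        using i by blast
    qed
    then have "\<not> 2 \<le> level x"
      using in_comb_of_lower_\<theta>[OF x] nonneg_comb_mono notin k(2) by blast
    then have "level x = 1"
      using level_pos[OF x] by simp
    then show "x \<in> range \<theta>"
      using level_one[OF x] by blast
  qed
qed

lemma weakly_independent_\<theta>:
  assumes "\<Gamma> \<subseteq> range \<theta>"
  shows "weakly_independent cartan \<Gamma>"
  unfolding weakly_independent_def
proof (intro conjI ballI)
  show "\<Gamma> \<subseteq> roots cartan"
    using assms real_root_\<theta> by (auto simp: roots_def)
  fix \<gamma> assume "\<gamma> \<in> \<Gamma>"
  then obtain e where e: "\<gamma> = \<theta> e"
    using assms by blast
  have "\<Gamma> - {\<gamma>} \<subseteq> Zs_pos_roots - {\<theta> e}"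
    using assms \<theta>_in_Zs_pos_roots e by auto
  then have "m *s \<gamma> = 0" if "m *s \<gamma> \<in> nonneg_comb (\<Gamma> - {\<gamma>})" for m
    using \<theta>_multiple_notin[of "\<Gamma> - {\<gamma>}" e m] that e by auto
  then show "range (\<lambda>m::int. m *s \<gamma>) \<inter> nonneg_comb (\<Gamma> - {\<gamma>}) = {0}"
    using zero_in_nonneg_comb[of "\<Gamma> - {\<gamma>}"] by (auto intro!: image_eqI[of 0 _ 0])
qed

lemma earlier_subset:
  "\<beta> ` {..<n} \<union> \<beta>' ` {..<n} \<subseteq> Zs_pos_roots - {\<beta> n, \<beta>' n}"
  using \<theta>_in_Zs_pos_roots by (auto simp: \<beta>_eq \<beta>'_eq dest!: injD[OF inj_\<theta>])

theorem mainTheorem3: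
  shows "is_weak_basis cartan (Zs_set cartan (\<alpha> 4)) (range \<beta> \<union> range \<beta>') \<and>
    (\<forall>n. \<forall>m::int. 0 < m \<longrightarrow>
       m *s \<beta> n \<notin> nonneg_comb (\<beta> ` {..<n} \<union> \<beta>' ` {..<n}) \<and>
       m *s \<beta>' n \<notin> nonneg_comb (\<beta> ` {..<n} \<union> \<beta>' ` {..<n})) \<and>
    (\<forall>n. weakly_independent cartan (\<beta> ` {1..n} \<union> \<beta>' ` {1..n}))"
proof (intro conjI allI impI)
  show "is_weak_basis cartan (Zs_set cartan (\<alpha> 4)) (range \<beta> \<union> range \<beta>')"
    unfolding range_\<theta> by (rule weak_basis_\<theta>)
next
  fix n and m :: int
  assume "0 < m"
  let ?S = "\<beta> ` {..<n} \<union> \<beta>' ` {..<n}"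
  have "?S \<subseteq> Zs_pos_roots - {\<theta> (- int n - 1)}" "?S \<subseteq> Zs_pos_roots - {\<theta> (int n)}"
    using earlier_subset[of n] by (auto simp flip: \<beta>_eq \<beta>'_eq)
  then show "m *s \<beta> n \<notin> nonneg_comb ?S" "m *s \<beta>' n \<notin> nonneg_comb ?S"
    using \<open>0 < m\<close> \<theta>_multiple_notin[of ?S _ m] by (simp_all add: \<beta>_eq[of n] \<beta>'_eq[of n])
next
  fix n
  show "weakly_independent cartan (\<beta> ` {1..n} \<union> \<beta>' ` {1..n})"
    using range_\<theta> by (intro weakly_independent_\<theta>) auto
qed

end
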